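(* For the code-capacity toric-code decoder (clock period $q=3$) on $\mathbb Z^2$ there exists a constant $a\ge1$ such that the following holds. Suppose the initial error configuration is supported in $B_r(\mathbf x)$ for some $r\ge1$ and $\mathbf x\in\mathbb Z^2$. Then: 1. All defects are eliminated by time $t\le ar$. 2. For all $t\ge0$, the correction and syndrome configurations are supported in $B_{ar}(\mathbf x)$.
   Context: Toric code (one CSS sector) on $\mathbb Z^2$: qubits live on nearest-neighbor edges; site $\mathbf r$ owns the edge joining $\mathbf r-\hat{\mathbf x}$ and $\mathbf r$ (bit $e_x(\mathbf r)$) and the edge joining $\mathbf r-\hat{\mathbf y}$ and $\mathbf r$ (bit $e_y(\mathbf r)$). The syndrome at $\mathbf r$ is the parity of errors on the four edges incident to $\mathbf r$; so flipping an edge toggles the syndromes at its two endpoints. A defect is a site with syndrome $1$. $B_r(\mathbf x)$ is the closed $\ell_1$ ball; an error/correction is said to be supported in a set of sites if its owning sites are. Decoder: site $\mathbf r$ at time $t$ carries bits $e_x,e_y,s$, message bits $m_{ij}$ for $(i,j)\in\mathcal M_2=\{(0,0),(0,1),(1,0)\}$, and a clock $c\in\{0,1,2\}$ ($q=3$). At $t=0$ all correction, message and clock variables are $0$ and $s$ is the syndrome of the (finite) initial error configuration. Define $\mathrm{Toom}_{ij}(\mathbf r,t)=\mathrm{Maj}\big(m_{ij}(\mathbf r,t),\,m_{ij}(\mathbf r+(-1)^{i+1}\hat{\mathbf x},t),\,m_{ij}(\mathbf r+(-1)^{j+1}\hat{\mathbf y},t)\big)$. Synchronous update $t\to t+1$: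 - $c(\mathbf r,t+1)=(c(\mathbf r,t)+1)\bmod3$. - If $s(\mathbf r,t)=1$ and $c(\mathbf r,t)=0$: if $m_{0j}(\mathbf r-\hat{\mathbf x},t)=1$ for some $j\in\{0,1\}$, flip $e_x(\mathbf r)$ (defect moves left to $\mathbf r-\hat{\mathbf x}$); otherwise, if $m_{i0}(\mathbf r-\hat{\mathbf y},t)=1$ for some $i\in\{0,1\}$, flip $e_y(\mathbf r)$ (defect moves down to $\mathbf r-\hat{\mathbf y}$). No other correction bits change. - $s(\cdot,t+1)$ is $s(\cdot,t)$ updated according to the changes of the corrections (so it is the syndrome of initial error plus current correction). - $m_{ij}(\mathbf r,t+1)=1$ iff at least one of: (i) $s(\mathbf r,t)=1$; (ii) some defect moves into $\mathbf r$ during this step; (iii) $s(\mathbf r,t)=0$, $m_{ij}(\mathbf r,t)=0$, $c(\mathbf r,t)\in\{0,1\}$, and $m_{ij}(\mathbf r+(-1)^{i+1}\hat{\mathbf x},t)=1$ or $m_{ij}(\mathbf r+(-1)^{j+1}\hat{\mathbf y},t)=1$; (iv) $s(\mathbf r,t)=0$, $m_{ij}(\mathbf r,t)=1$, and $\mathrm{Toom}_{ij}(\mathbf r,t)=1$; (v) $s(\mathbf r,t)=0$, $m_{ij}(\mathbf r,t)=1$, $(i,j)\ne(0,0)$, $m_{00}(\mathbf r,t)=1$, and $\mathrm{Toom}_{00}(\mathbf r,t)=1$. Otherwise it is $0$. *)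

theory Defs
  imports Complex_Main "HOL-Library.Product_Plus"
begin

type_synonym site = "int \<times> int"

abbreviation xhat :: site where "xhat \<equiv> (1, 0)"
abbreviation yhat :: site where "yhat \<equiv> (0, 1)"

definition l1_ball :: "site \<Rightarrow> real \<Rightarrow> site set" where
  "l1_ball x r = {y. real_of_int (\<bar>fst y - fst x\<bar> + \<bar>snd y - snd x\<bar>) \<le> r}"

text \<open>A bit on every edge, indexed by the site owning the edge: \<open>edge_x e p\<close> belongs to the
  edge joining \<open>p - xhat\<close> and \<open>p\<close>, and \<open>edge_y e p\<close> to the edge joining \<open>p - yhat\<close> and \<open>p\<close>.\<close>

record edge_config =
  edge_x :: "site \<Rightarrow> bool"
  edge_y :: "site \<Rightarrow> bool"

definition edge_supp :: "edge_config \<Rightarrow> site set" where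
  "edge_supp e = {p. edge_x e p \<or> edge_y e p}"

definition edge_add :: "edge_config \<Rightarrow> edge_config \<Rightarrow> edge_config" where
  "edge_add e f = \<lparr>edge_x = (\<lambda>p. edge_x e p \<noteq> edge_x f p), edge_y = (\<lambda>p. edge_y e p \<noteq> edge_y f p)\<rparr>"

definition syndrome :: "edge_config \<Rightarrow> site \<Rightarrow> bool" where
  "syndrome e p \<longleftrightarrow>
     odd (of_bool (edge_x e p) + of_bool (edge_x e (p + xhat)) +
          of_bool (edge_y e p) + of_bool (edge_y e (p + yhat)) :: nat)"

definition M2 :: "(nat \<times> nat) set" where
  "M2 = {(0, 0), (0, 1), (1, 0)}"

text \<open>\<open>msg S i j p\<close> is meaningful only for \<open>(i, j) \<in> M2\<close>; it is kept \<open>False\<close> for all other indices.\<close>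

record state =
  corr :: edge_config
  synd :: "site \<Rightarrow> bool"
  msg :: "nat \<Rightarrow> nat \<Rightarrow> site \<Rightarrow> bool"
  clk :: "site \<Rightarrow> nat"

definition init :: "edge_config \<Rightarrow> state" where
  "init e = \<lparr>corr = \<lparr>edge_x = (\<lambda>_. False), edge_y = (\<lambda>_. False)\<rparr>, synd = syndrome e,
     msg = (\<lambda>_ _ _. False), clk = (\<lambda>_. 0)\<rparr>"

definition nbr_x :: "nat \<Rightarrow> site \<Rightarrow> site" where
  "nbr_x i p = p + ((-1) ^ (i + 1), 0)"

definition nbr_y :: "nat \<Rightarrow> site \<Rightarrow> site" where
  "nbr_y j p = p + (0, (-1) ^ (j + 1))"

definition maj :: "bool \<Rightarrow> bool \<Rightarrow> bool \<Rightarrow> bool" where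
  "maj a b c \<longleftrightarrow> (a \<and> b) \<or> (a \<and> c) \<or> (b \<and> c)"

definition toom :: "state \<Rightarrow> nat \<Rightarrow> nat \<Rightarrow> site \<Rightarrow> bool" where
  "toom S i j p \<longleftrightarrow> maj (msg S i j p) (msg S i j (nbr_x i p)) (msg S i j (nbr_y j p))"

definition moves_left :: "state \<Rightarrow> site \<Rightarrow> bool" where
  "moves_left S p \<longleftrightarrow> synd S p \<and> clk S p = 0 \<and> (\<exists>j\<in>{0, 1}. msg S 0 j (p - xhat))"

definition moves_down :: "state \<Rightarrow> site \<Rightarrow> bool" where
  "moves_down S p \<longleftrightarrow>
     synd S p \<and> clk S p = 0 \<and> \<not> moves_left S p \<and> (\<exists>i\<in>{0, 1}. msg S i 0 (p - yhat))"

definition flips :: "state \<Rightarrow> edge_config" where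
  "flips S = \<lparr>edge_x = moves_left S, edge_y = moves_down S\<rparr>"

definition enters :: "state \<Rightarrow> site \<Rightarrow> bool" where
  "enters S p \<longleftrightarrow> moves_left S (p + xhat) \<or> moves_down S (p + yhat)"

definition msg_update :: "state \<Rightarrow> nat \<Rightarrow> nat \<Rightarrow> site \<Rightarrow> bool" where
  "msg_update S i j p \<longleftrightarrow> (i, j) \<in> M2 \<and>
     (synd S p \<or>
      enters S p \<or>
      (\<not> synd S p \<and> \<not> msg S i j p \<and> clk S p \<in> {0, 1} \<and>
         (msg S i j (nbr_x i p) \<or> msg S i j (nbr_y j p))) \<or>
      (\<not> synd S p \<and> msg S i j p \<and> toom S i j p) \<or>
      (\<not> synd S p \<and> msg S i j p \<and> (i, j) \<noteq> (0, 0) \<and> msg S 0 0 p \<and> toom S 0 0 p))"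

definition step :: "state \<Rightarrow> state" where
  "step S = \<lparr>corr = edge_add (corr S) (flips S),
     synd = (\<lambda>p. synd S p \<noteq> syndrome (flips S) p),
     msg = msg_update S,
     clk = (\<lambda>p. (clk S p + 1) mod 3)\<rparr>"

definition decoder :: "edge_config \<Rightarrow> nat \<Rightarrow> state" where
  "decoder e t = (step ^^ t) (init e)"

definition defects :: "state \<Rightarrow> site set" where
  "defects S = {p. synd S p}"

lemma syndrome_edge_add: "syndrome (edge_add e f) p \<longleftrightarrow> (syndrome e p \<noteq> syndrome f p)"
  by (auto simp: syndrome_def edge_add_def)

lemma synd_decoder: "synd (decoder e t) = syndrome (edge_add e (corr (decoder e t)))"
proof (induction t)
  case 0
  show ?case by (simp add: decoder_def init_def edge_add_def syndrome_def fun_eq_iff)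
next
  case (Suc t)
  have "decoder e (Suc t) = step (decoder e t)"
    by (simp add: decoder_def)
  then show ?case
    using Suc by (auto simp: step_def syndrome_edge_add fun_eq_iff)
qed

end

theory Submission
  imports Defs
begin

text \<open>
  Defects only move left or down, and the messages that trigger left (down) moves never travel left
  (down), so everything stays in the initial bounding box. In particular a defect makes only
  \<open>O(r)\<close> moves. Trace two defects alive at time \<open>T\<close> back to time 0. The messages emitted along
  a worldline fill growing \<open>\<ell>\<^sub>1\<close> cones at every site it visited, so a defect moves in each
  clock period in which it is to the right of, or above, a sufficiently old position of the
  other defect. Hence if the two are at distance \<open>d\<close>, they made at least \<open>d / 4\<close> moves
  during the preceding \<open>2 d\<close> clock periods. Iterating this backwards bounds \<open>T\<close> linearly in the
  number of moves. From then on there is at most one defect, and by parity there is none.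
\<close>

section \<open>Worldlines of defects\<close>

definition next_site :: "state \<Rightarrow> site \<Rightarrow> site" where
  "next_site S p = (if moves_left S p then p - xhat else if moves_down S p then p - yhat else p)"

text \<open>A site that no defect enters can only lose its own defect, so a defect found there
  afterwards has stayed put. Hence defects can always be traced backwards in time, where
  annihilation does not interfere.\<close>

lemma synd_step_origin:
  assumes "synd (step S) p"
  obtains u where "synd S u" "next_site S u = p"
proof -
  have md: "\<not> moves_left S v" if "moves_down S v" for v
    using that by (simp add: moves_down_def)
  have sl: "synd S v" if "moves_left S v" for v
    using that by (simp add: moves_left_def)
  have sd: "synd S v" if "moves_down S v" for v
    using that by (simp add: moves_down_def)
  consider "moves_left S (p + xhat)" | "moves_down S (p + yhat)"
    | "\<not> moves_left S (p + xhat)" "\<not> moves_down S (p + yhat)" by blast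
  then show thesis
  proof cases
    case 1
    then show thesis using that[of "p + xhat"] sl by (simp add: next_site_def)
  next
    case 2
    then show thesis using that[of "p + yhat"] sd md by (simp add: next_site_def)
  next
    case 3
    then have "synd S p \<noteq> (moves_left S p \<noteq> moves_down S p)"
      using assms by (simp add: step_def syndrome_def flips_def)
    then have "synd S p" "\<not> moves_left S p" "\<not> moves_down S p"
      using sl sd md by blast+
    then show thesis using that[of p] by (simp add: next_site_def)
  qed
qed

lemma msg_next_site:
  assumes "synd S u" "(i, j) \<in> M2"
  shows "msg (step S) i j (next_site S u)"
  using assms by (auto simp: step_def msg_update_def next_site_def enters_def)

lemma decoder_Suc: "decoder e (Suc t) = step (decoder e t)"
  by (simp add: decoder_def)

lemma clk_decoder: "clk (decoder e t) p = t mod 3"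
proof (induction t)
  case (Suc t)
  then show ?case by (simp add: decoder_Suc step_def mod_Suc_eq)
qed (simp add: decoder_def init_def)

definition worldline :: "edge_config \<Rightarrow> nat \<Rightarrow> (nat \<Rightarrow> site) \<Rightarrow> bool" where
  "worldline e T w \<longleftrightarrow> (\<forall>t\<le>T. synd (decoder e t) (w t)) \<and>
     (\<forall>t<T. w (Suc t) = next_site (decoder e t) (w t))"

lemma worldline_exists:
  assumes "synd (decoder e T) p"
  obtains w where "worldline e T w" "w T = p"
proof -
  have "\<exists>w. worldline e T w \<and> w T = p"
    using assms
  proof (induction T arbitrary: p)
    case 0
    then show ?case by (intro exI[of _ "\<lambda>_. p"]) (simp add: worldline_def)
  next
    case (Suc T)
    then obtain u where u: "synd (decoder e T) u" "next_site (decoder e T) u = p"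
      using synd_step_origin by (metis decoder_Suc)
    with Suc.IH obtain w where w: "worldline e T w" "w T = u" by blast
    then have "worldline e (Suc T) (w(Suc T := p))"
      using u Suc.prems by (auto simp: worldline_def le_Suc_eq less_Suc_eq)
    moreover have "(w(Suc T := p)) (Suc T) = p" by simp
    ultimately show ?case by blast
  qed
  then show thesis using that by blast
qed

text \<open>The next site depends only on the time and the present site, so worldlines that meet
  stay together from then on.\<close>

lemma worldline_disjoint:
  assumes "worldline e T v" "worldline e T w" "v T \<noteq> w T" "t \<le> T"
  shows "v t \<noteq> w t"
proof
  assume "v t = w t"
  have "v s = w s" if "t \<le> s" "s \<le> T" for s
    using that
  proof (induction s rule: dec_induct)
    case base
    then show ?case using \<open>v t = w t\<close> by simp
  next
    case (step s)
    then show ?case using assms(1,2) by (simp add: worldline_def)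
  qed
  then show False using assms(3,4) by blast
qed

section \<open>Message cones along a worldline\<close>

definition cone :: "nat \<Rightarrow> nat \<Rightarrow> site \<Rightarrow> int \<Rightarrow> site set" where
  "cone i j c \<rho> = {v. 0 \<le> (-1) ^ i * (fst v - fst c) \<and> 0 \<le> (-1) ^ j * (snd v - snd c) \<and>
     (-1) ^ i * (fst v - fst c) + (-1) ^ j * (snd v - snd c) \<le> \<rho>}"

lemma cone_mono: "\<rho> \<le> \<rho>' \<Longrightarrow> cone i j c \<rho> \<subseteq> cone i j c \<rho>'"
  by (auto simp: cone_def)

lemma cone_apex: "0 \<le> \<rho> \<Longrightarrow> c \<in> cone i j c \<rho>"
  by (simp add: cone_def)

lemma cone_singleton: "(i, j) \<in> M2 \<Longrightarrow> cone i j c 0 = {c}"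
  by (auto simp: cone_def M2_def prod_eq_iff)

text \<open>\<open>nbr_x i\<close> and \<open>nbr_y j\<close> step against the directions in which
  the cone opens, so away from the apex at least one of them leads towards it inside the
  cone.\<close>

lemma cone_neighbour:
  assumes "v \<in> cone i j c \<rho>" "v \<noteq> c" "(i, j) \<in> M2"
  shows "nbr_x i v \<in> cone i j c (\<rho> - 1) \<or> nbr_y j v \<in> cone i j c (\<rho> - 1)"
  using assms by (auto simp: cone_def nbr_x_def nbr_y_def M2_def prod_eq_iff)

lemma msg_update_spread:
  assumes "(i, j) \<in> M2" "msg S i j (nbr_x i p) \<or> msg S i j (nbr_y j p)"
    "clk S p \<in> {0, 1} \<or> msg S i j p"
  shows "msg_update S i j p"
  using assms unfolding msg_update_def toom_def maj_def by blast

text \<open>When a worldline leaves a site, the next site carries message \<open>(0, 0)\<close>. For the two other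
  message types the next site need not be a Toom neighbour, so rule (v) is needed here.\<close>

lemma msg_update_departed:
  assumes "(i, j) \<in> M2" "msg S i j p" "msg S 0 0 p"
    "msg S 0 0 (p - xhat) \<or> msg S 0 0 (p - yhat)"
  shows "msg_update S i j p"
proof -
  have "toom S 0 0 p"
    using assms(3,4) by (auto simp: toom_def maj_def nbr_x_def nbr_y_def minus_prod_def plus_prod_def)
  then show ?thesis
    using assms(1-3) unfolding msg_update_def by blast
qed

text \<open>The number of spreading steps (those at clock value 0 or 1) before time \<open>t\<close>.\<close>

definition spread_time :: "nat \<Rightarrow> int" where
  "spread_time t = int (t - t div 3)"

lemma spread_time_Suc:
  "spread_time (Suc t) = (if t mod 3 = 2 then spread_time t else spread_time t + 1)"
  by (simp add: spread_time_def div_Suc mod_Suc of_nat_diff)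

lemma spread_time_mono: "s \<le> t \<Longrightarrow> spread_time s \<le> spread_time t"
  by (induction t rule: dec_induct) (auto simp: spread_time_Suc)

text \<open>Induction on \<open>t\<close>, for all \<open>s\<close> and all message types at once.
  Off the apex a neighbour nearer to it carries the message, which creates the bit by rule (iii) or
  lets the Toom majority keep it. At an abandoned apex the message at the site entered next
  preserves it. The bound \<open>1 <= s\<close> reflects that there are no messages at time
  0.\<close>

lemma worldline_cone:
  assumes w: "worldline e T w"
    and "t \<le> T" "1 \<le> s" "s \<le> t" "(i, j) \<in> M2"
    and "v \<in> cone i j (w s) (spread_time t - spread_time s)"
  shows "msg (decoder e t) i j v"
  using assms(2-)
proof (induction t arbitrary: s i j v)
  case 0
  then show ?case by simp
next
  case (Suc t)
  let ?S = "decoder e t"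
  have IH: "msg ?S i j v" if "1 \<le> s" "s \<le> t" "(i, j) \<in> M2"
    "v \<in> cone i j (w s) (spread_time t - spread_time s)" for s i j v
    using Suc.IH that Suc.prems(1) by simp
  have synd: "synd ?S (w t)" and nxt: "w (Suc t) = next_site ?S (w t)"
    using w Suc.prems(1) by (simp_all add: worldline_def)
  show ?case
  proof (cases "s = Suc t")
    case True
    then have "v = w (Suc t)"
      using cone_singleton[OF Suc.prems(4)] Suc.prems(5) by simp
    then show ?thesis
      using msg_next_site[OF synd] Suc.prems(4) nxt by (simp add: decoder_Suc)
  next
    case False
    then have s: "1 \<le> s" "s \<le> t" using Suc.prems(2,3) by simp_all
    note ij = Suc.prems(4)
    have "msg_update ?S i j v"
    proof (cases "v = w s")
      case False
      let ?\<rho> = "spread_time (Suc t) - spread_time s"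
      have "cone i j (w s) (?\<rho> - 1) \<subseteq> cone i j (w s) (spread_time t - spread_time s)"
        by (intro cone_mono) (simp add: spread_time_Suc)
      then have "msg ?S i j (nbr_x i v) \<or> msg ?S i j (nbr_y j v)"
        using cone_neighbour[OF Suc.prems(5) False ij] IH[OF s ij] by blast
      \<comment> \<open>At clock value 2 no bit is created by spreading, but the radius stalls as
        well, so the bit at \<open>v\<close> is already set.\<close>
      moreover have "clk ?S v \<in> {0, 1} \<or> msg ?S i j v"
      proof (cases "t mod 3 = 2")
        case True
        then have "spread_time (Suc t) = spread_time t" by (simp add: spread_time_Suc)
        then show ?thesis using IH[OF s ij] Suc.prems(5) by simp
      next
        case False
        then have "t mod 3 = 0 \<or> t mod 3 = 1" by linarith
        then show ?thesis by (simp add: clk_decoder)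
      qed
      ultimately show ?thesis using ij by (intro msg_update_spread)
    next
      case v: True
      show ?thesis
      proof (cases "synd ?S v")
        case True
        then show ?thesis using ij by (simp add: msg_update_def)
      next
        case False
        \<comment> \<open>\<open>w t\<close> is a defect and \<open>v\<close> is not, so the
          worldline left \<open>v\<close> in some step \<open>n\<close> in between. By the induction
          hypothesis for times \<open>n\<close> and \<open>Suc n\<close>, both \<open>v\<close> and
          the site entered carry message \<open>(0, 0)\<close> at time \<open>t\<close>.\<close>
        have "\<exists>n. s \<le> n \<and> n < t \<and> w n = v \<and> w (Suc n) \<noteq> v"
        proof (rule ccontr)
          assume no: "\<not> ?thesis"
          have "w n = v" if "s \<le> n" "n \<le> t" for n
            using that
          proof (induction n rule: dec_induct)
            case base
            then show ?case using v by simp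
          next
            case (step n)
            then show ?case using no by (meson Suc_le_lessD less_imp_le)
          qed
          then show False using False synd s by blast
        qed
        then obtain n where n: "s \<le> n" "n < t" "w n = v" "w (Suc n) \<noteq> v" by blast
        have at: "msg ?S a b (w m)" if "(a, b) \<in> M2" "1 \<le> m" "m \<le> t" for a b m
          using that spread_time_mono[OF that(3)] by (intro IH[of m] cone_apex) simp_all
        have M00: "(0, 0) \<in> M2" by (simp add: M2_def)
        have "w (Suc n) = next_site (decoder e n) v"
          using w n(2,3) Suc.prems(1) by (simp add: worldline_def)
        then have "w (Suc n) = v - xhat \<or> w (Suc n) = v - yhat"
          using n(4) by (auto simp: next_site_def split: if_splits)
        moreover have "msg ?S 0 0 (w (Suc n))"
          using at[OF M00, of "Suc n"] n s by simp
        ultimately have "msg ?S 0 0 (v - xhat) \<or> msg ?S 0 0 (v - yhat)"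
          by metis
        moreover have "msg ?S i j v" "msg ?S 0 0 v"
          using at[OF ij, of n] at[OF M00, of n] n s by simp_all
        ultimately show ?thesis
          by (intro msg_update_departed[OF ij])
      qed
    qed
    then show ?thesis by (simp add: decoder_Suc step_def)
  qed
qed

section \<open>Worldlines sampled once per clock period\<close>

definition l1_dist :: "site \<Rightarrow> site \<Rightarrow> int" where
  "l1_dist u v = \<bar>fst u - fst v\<bar> + \<bar>snd u - snd v\<bar>"

definition height :: "site \<Rightarrow> int" where
  "height p = fst p + snd p"

lemma l1_dist_commute: "l1_dist u v = l1_dist v u"
  by (simp add: l1_dist_def abs_minus_commute)

text \<open>Moves occur only at times divisible by 3. Sampling right after them, at times
  \<open>3 * k + 1\<close>, makes even sample 0 late enough for
  \<open>worldline_cone\<close>.\<close>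

lemma worldline_period:
  assumes "worldline e T w" "3 * k + 4 \<le> T"
  shows "w (3 * k + 3) = w (3 * k + 1)"
    and "w (3 * k + 4) = next_site (decoder e (3 * k + 3)) (w (3 * k + 1))"
proof -
  have Suc_w: "w (Suc t) = next_site (decoder e t) (w t)" if "t < T" for t
    using assms(1) that by (simp add: worldline_def)
  have stay: "w (Suc t) = w t" if "t mod 3 \<noteq> 0" "t < T" for t
    using Suc_w[OF that(2)] that(1)
    by (simp add: next_site_def moves_left_def moves_down_def clk_decoder)
  have mods: "(3 * k + 1) mod 3 \<noteq> 0" "(3 * k + 2) mod 3 \<noteq> 0" by presburger+
  have Sucs: "Suc (3 * k + 1) = 3 * k + 2" "Suc (3 * k + 2) = 3 * k + 3" "Suc (3 * k + 3) = 3 * k + 4"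
    by simp_all
  show w3: "w (3 * k + 3) = w (3 * k + 1)"
    using stay[OF mods(1)] stay[OF mods(2)] assms(2) unfolding Sucs by simp
  show "w (3 * k + 4) = next_site (decoder e (3 * k + 3)) (w (3 * k + 1))"
    using Suc_w[of "3 * k + 3"] assms(2) unfolding Sucs w3 by simp
qed

text \<open>A defect trailing another one sees its messages, which spread at twice its own maximal
  speed.\<close>

lemma worldline_pulled:
  assumes v: "worldline e T v" and w: "worldline e T w"
    and "3 * k + 4 \<le> T" "m \<le> k"
    and "fst (w (3 * m + 1)) < fst (v (3 * k + 1)) \<or> snd (w (3 * m + 1)) < snd (v (3 * k + 1))"
    and "l1_dist (v (3 * k + 1)) (w (3 * m + 1)) \<le> 2 * (int k - int m)"
  shows "v (3 * Suc k + 1) \<noteq> v (3 * k + 1)"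
proof -
  let ?S = "decoder e (3 * k + 3)" and ?p = "v (3 * k + 1)" and ?c = "w (3 * m + 1)"
  note period = worldline_period[OF v assms(3)]
  have synd: "synd ?S ?p"
    using v assms(3) unfolding period(1)[symmetric] worldline_def by simp
  have next': "v (3 * Suc k + 1) = next_site ?S ?p"
    using period(2) by (simp add: add.commute)
  have clk: "clk ?S ?p = 0"
    by (simp add: clk_decoder)
  have spread: "spread_time (3 * k + 3) - spread_time (3 * m + 1) = 2 * (int k - int m) + 1"
  proof -
    have "(3 * k + 3) div 3 = k + 1" "(3 * m + 1) div 3 = m" by simp_all
    then show ?thesis unfolding spread_time_def by simp
  qed
  have msg: "msg ?S i j u" if "(i, j) \<in> M2" "u \<in> cone i j ?c (2 * (int k - int m) + 1)" for i j u
    using worldline_cone[OF w, of "3 * k + 3" "3 * m + 1" i j u] assms(3,4) that spread by simp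
  have "moves_left ?S ?p \<or> moves_down ?S ?p"
    using assms(5)
  proof
    assume "fst ?c < fst ?p"
    \<comment> \<open>Not being to the left of \<open>?c\<close>, the site lies in the quadrant of
      message \<open>(0, 0)\<close> or \<open>(0, 1)\<close>, according to whether it is above or
      below \<open>?c\<close>; either message triggers a left move.\<close>
    then have "?p - xhat \<in> cone 0 0 ?c (2 * (int k - int m) + 1) \<or>
        ?p - xhat \<in> cone 0 1 ?c (2 * (int k - int m) + 1)"
      using assms(6) by (auto simp: cone_def l1_dist_def)
    then have "msg ?S 0 0 (?p - xhat) \<or> msg ?S 0 1 (?p - xhat)"
      using msg[of 0 0 "?p - xhat"] msg[of 0 1 "?p - xhat"] unfolding M2_def by blast
    then show ?thesis
      using synd clk unfolding moves_left_def by blast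
  next
    assume "snd ?c < snd ?p"
    then have "?p - yhat \<in> cone 0 0 ?c (2 * (int k - int m) + 1) \<or>
        ?p - yhat \<in> cone 1 0 ?c (2 * (int k - int m) + 1)"
      using assms(6) by (auto simp: cone_def l1_dist_def)
    then have "msg ?S 0 0 (?p - yhat) \<or> msg ?S 1 0 (?p - yhat)"
      using msg[of 0 0 "?p - yhat"] msg[of 1 0 "?p - yhat"] unfolding M2_def by blast
    then show ?thesis
      using synd clk unfolding moves_down_def by blast
  qed
  then show ?thesis
    using next' by (auto simp: next_site_def prod_eq_iff)
qed

section \<open>Pursuit of two descending sequences\<close>

definition descending :: "nat \<Rightarrow> (nat \<Rightarrow> site) \<Rightarrow> bool" where
  "descending K P \<longleftrightarrow> (\<forall>k<K. P (Suc k) \<in> {P k, P k - xhat, P k - yhat})"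

text \<open>Abstracts \<open>worldline_pulled\<close>; the factor 2 is the number of spreading steps
  per clock period.\<close>

definition pulled_by :: "nat \<Rightarrow> (nat \<Rightarrow> site) \<Rightarrow> (nat \<Rightarrow> site) \<Rightarrow> bool" where
  "pulled_by K P Q \<longleftrightarrow> (\<forall>k<K. \<forall>m\<le>k. (fst (Q m) < fst (P k) \<or> snd (Q m) < snd (P k)) \<longrightarrow>
     l1_dist (P k) (Q m) \<le> 2 * (int k - int m) \<longrightarrow> P (Suc k) \<noteq> P k)"

lemma descending_le:
  assumes "descending K P" "m \<le> n" "n \<le> K"
  shows "fst (P n) \<le> fst (P m) \<and> snd (P n) \<le> snd (P m)"
  using assms(2,3)
proof (induction n rule: dec_induct)
  case (step n)
  then have "P (Suc n) \<in> {P n, P n - xhat, P n - yhat}"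
    using assms(1) unfolding descending_def by simp
  with step show ?case by auto
qed simp

text \<open>If there were fewer than \<open>d / 4\<close> moves, the separation of the final positions in one
  coordinate would persist over the whole window, and \<open>P\<close> would move in its last \<open>d\<close> periods.\<close>

lemma pulled_window_left:
  assumes P: "descending K P" and Q: "descending K Q" and pull: "pulled_by K P Q"
    and k: "k0 + 2 * d \<le> K" "1 \<le> d"
    and d: "l1_dist (P (k0 + 2 * d)) (Q (k0 + 2 * d)) = int d"
    and far: "int d \<le> 2 * (fst (P (k0 + 2 * d)) - fst (Q (k0 + 2 * d))) \<or>
      int d \<le> 2 * (snd (P (k0 + 2 * d)) - snd (Q (k0 + 2 * d)))"
  shows "int d \<le> 4 * (height (P k0) + height (Q k0) -
    height (P (k0 + 2 * d)) - height (Q (k0 + 2 * d)))"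
proof (rule ccontr)
  let ?k = "k0 + 2 * d"
  assume few: "\<not> ?thesis"
  have Q0: "fst (Q ?k) \<le> fst (Q k0)" "snd (Q ?k) \<le> snd (Q k0)"
    using descending_le[OF Q, of k0 ?k] k by auto
  have move: "height (P (Suc n)) = height (P n) - 1" if "k0 + d \<le> n" "n < ?k" for n
  proof -
    have "fst (P n) \<le> fst (P k0)" "snd (P n) \<le> snd (P k0)"
      "fst (P ?k) \<le> fst (P n)" "snd (P ?k) \<le> snd (P n)"
      using descending_le[OF P, of k0 n] descending_le[OF P, of n ?k] that k by auto
    note bounds = this Q0 few[unfolded height_def ring_distribs not_le]
    \<comment> \<open>Fewer than \<open>d / 4\<close> moves happen in the whole window, so a final
      separation of at least \<open>d / 2\<close> in one coordinate leaves more than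
      \<open>d / 4\<close> between \<open>P n\<close> and the old position
      \<open>Q k0\<close>.\<close>
    from far have "fst (Q k0) < fst (P n) \<or> snd (Q k0) < snd (P n)"
    proof
      assume "int d \<le> 2 * (fst (P ?k) - fst (Q ?k))"
      with bounds k(2) have "fst (Q k0) < fst (P n)" unfolding ring_distribs by linarith
      then show ?thesis ..
    next
      assume "int d \<le> 2 * (snd (P ?k) - snd (Q ?k))"
      with bounds k(2) have "snd (Q k0) < snd (P n)" unfolding ring_distribs by linarith
      then show ?thesis ..
    qed
    \<comment> \<open>The distance exceeds \<open>d\<close> by at most the number of moves, while
      \<open>Q k0\<close> is at least \<open>d\<close> periods old.\<close>
    moreover have "l1_dist (P n) (Q k0) \<le> 2 * int d"
      using d bounds unfolding l1_dist_def by linarith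
    moreover have "2 * int d \<le> 2 * (int n - int k0)" "k0 \<le> n" "n < K"
      using that k by auto
    ultimately have "P (Suc n) \<noteq> P n"
      using pull unfolding pulled_by_def by (meson order_trans)
    moreover have "P (Suc n) \<in> {P n, P n - xhat, P n - yhat}"
      using P \<open>n < K\<close> unfolding descending_def by blast
    ultimately show ?thesis by (auto simp: height_def)
  qed
  \<comment> \<open>Thus \<open>P\<close> alone makes \<open>d\<close> moves in the second half of
    the window, which is too many.\<close>
  have "height (P n) = height (P (k0 + d)) - int (n - (k0 + d))" if "k0 + d \<le> n" "n \<le> ?k" for n
    using that
  proof (induction n rule: dec_induct)
    case (step n)
    then show ?case using move[of n] by (simp add: Suc_diff_le)
  qed simp
  from this[of ?k] have "height (P ?k) = height (P (k0 + d)) - int d" by simp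
  moreover have "height (P (k0 + d)) \<le> height (P k0)"
    using descending_le[OF P, of k0 "k0 + d"] k by (simp add: height_def)
  moreover have "height (Q ?k) \<le> height (Q k0)"
    using Q0 by (simp add: height_def)
  ultimately show False using few k(2) unfolding ring_distribs by linarith
qed

lemma pulled_window:
  assumes P: "descending K P" and Q: "descending K Q"
    and pull: "pulled_by K P Q" "pulled_by K Q P"
    and k: "k0 + 2 * d \<le> K" "1 \<le> d"
    and d: "l1_dist (P (k0 + 2 * d)) (Q (k0 + 2 * d)) = int d"
  shows "int d \<le> 4 * (height (P k0) + height (Q k0) -
    height (P (k0 + 2 * d)) - height (Q (k0 + 2 * d)))"
proof -
  let ?p = "P (k0 + 2 * d)" and ?q = "Q (k0 + 2 * d)"
  \<comment> \<open>The larger coordinate difference is at least half the distance; its sign decides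
    which sequence is the trailing one.\<close>
  have "(int d \<le> 2 * (fst ?p - fst ?q) \<or> int d \<le> 2 * (snd ?p - snd ?q)) \<or>
      (int d \<le> 2 * (fst ?q - fst ?p) \<or> int d \<le> 2 * (snd ?q - snd ?p))"
    using d unfolding l1_dist_def by arith
  then show ?thesis
  proof
    assume "int d \<le> 2 * (fst ?p - fst ?q) \<or> int d \<le> 2 * (snd ?p - snd ?q)"
    then show ?thesis by (rule pulled_window_left[OF P Q pull(1) k d])
  next
    assume "int d \<le> 2 * (fst ?q - fst ?p) \<or> int d \<le> 2 * (snd ?q - snd ?p)"
    moreover have "l1_dist ?q ?p = int d" using d by (simp add: l1_dist_commute)
    ultimately show ?thesis using pulled_window_left[OF Q P pull(2) k] by simp
  qed
qed

text \<open>Windows of \<open>2 * d\<close> periods are cut off from the end, each paid for by a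
  height loss of at least \<open>d / 4\<close>, hence the factor 8. The piece left at the start is
  shorter than \<open>2 * d\<close>, hence at most \<open>2 * D\<close>.\<close>

lemma pursuit_time:
  assumes P: "descending K P" and Q: "descending K Q"
    and pull: "pulled_by K P Q" "pulled_by K Q P"
    and ne: "\<And>k. k \<le> K \<Longrightarrow> P k \<noteq> Q k"
    and D: "\<And>k. k \<le> K \<Longrightarrow> l1_dist (P k) (Q k) \<le> D"
    and "k \<le> K"
  shows "int k \<le> 8 * (height (P 0) + height (Q 0) - height (P k) - height (Q k)) + 2 * D"
  using \<open>k \<le> K\<close>
proof (induction k rule: less_induct)
  case (less k)
  define d where "d = nat (l1_dist (P k) (Q k))"
  have d: "l1_dist (P k) (Q k) = int d"
    unfolding d_def l1_dist_def by simp
  have "l1_dist (P k) (Q k) \<noteq> 0"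
    using ne[OF less.prems] unfolding l1_dist_def by (auto simp: prod_eq_iff)
  then have "1 \<le> d" using d by simp
  show ?case
  proof (cases "2 * d \<le> k")
    case True
    define k0 where "k0 = k - 2 * d"
    have k: "k = k0 + 2 * d" using True k0_def by simp
    have "int d \<le> 4 * (height (P k0) + height (Q k0) - height (P k) - height (Q k))"
      using pulled_window[OF P Q pull, of k0 d] less.prems \<open>1 \<le> d\<close> d k by simp
    moreover have "int k0 \<le> 8 * (height (P 0) + height (Q 0) - height (P k0) - height (Q k0)) + 2 * D"
      using less.IH[of k0] less.prems k \<open>1 \<le> d\<close> by simp
    moreover have "int k = int k0 + 2 * int d" using k by simp
    ultimately show ?thesis unfolding ring_distribs by linarith
  next
    case False
    moreover have "height (P k) \<le> height (P 0)" "height (Q k) \<le> height (Q 0)"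
      using descending_le[OF P, of 0 k] descending_le[OF Q, of 0 k] less.prems
      by (auto simp: height_def)
    ultimately show ?thesis using D[OF less.prems] d unfolding ring_distribs by linarith
  qed
qed

lemma worldline_descending:
  assumes "worldline e T w" "3 * K + 1 \<le> T"
  shows "descending K (\<lambda>k. w (3 * k + 1))"
  unfolding descending_def
proof (intro allI impI)
  fix k assume "k < K"
  then have "w (3 * k + 4) = next_site (decoder e (3 * k + 3)) (w (3 * k + 1))"
    using assms by (intro worldline_period(2)) auto
  then show "w (3 * Suc k + 1) \<in> {w (3 * k + 1), w (3 * k + 1) - xhat, w (3 * k + 1) - yhat}"
    by (simp add: next_site_def eval_nat_numeral)
qed

section \<open>Confinement to a box\<close>

definition box :: "site \<Rightarrow> int \<Rightarrow> site set" where
  "box x R = {fst x - R..fst x + R} \<times> {snd x - R..snd x + R}"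

text \<open>Left moves are triggered only by messages with \<open>i = 0\<close>, which never spread
  to the left, so a lower bound on their first coordinate holds defects inside; likewise
  \<open>j = 0\<close> and down moves. On the other two sides defects stay inside because they never
  move right or up.\<close>

definition confined :: "site \<Rightarrow> int \<Rightarrow> state \<Rightarrow> bool" where
  "confined x R S \<longleftrightarrow> defects S \<subseteq> box x R \<and> edge_supp (corr S) \<subseteq> box x R \<and>
     (\<forall>i j p. msg S i j p \<longrightarrow>
        (i = 0 \<longrightarrow> fst x - R \<le> fst p) \<and> (j = 0 \<longrightarrow> snd x - R \<le> snd p))"

lemma confined_step:
  assumes "confined x R S"
  shows "confined x R (step S)"
proof -
  have synd: "p \<in> box x R" if "synd S p" for p
    using assms that by (auto simp: confined_def defects_def)
  have corr: "p \<in> box x R" if "edge_x (corr S) p \<or> edge_y (corr S) p" for p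
    using assms that by (auto simp: confined_def edge_supp_def)
  have msg: "(i = 0 \<longrightarrow> fst x - R \<le> fst p) \<and> (j = 0 \<longrightarrow> snd x - R \<le> snd p)" if "msg S i j p" for i j p
    using assms that unfolding confined_def by blast
  have next': "next_site S p \<in> box x R" if "synd S p" for p
  proof -
    have "p - xhat \<in> box x R" if "moves_left S p"
      using that msg[of 0 _ "p - xhat"] synd[OF \<open>synd S p\<close>] by (auto simp: moves_left_def box_def)
    moreover have "p - yhat \<in> box x R" if "moves_down S p"
      using that msg[of _ 0 "p - yhat"] synd[OF \<open>synd S p\<close>] by (auto simp: moves_down_def box_def)
    ultimately show ?thesis
      using synd[OF that] by (simp add: next_site_def)
  qed
  have ent: "p \<in> box x R" if "enters S p" for p
  proof -
    have "\<exists>u. synd S u \<and> next_site S u = p"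
      using that unfolding enters_def
    proof
      assume "moves_left S (p + xhat)"
      then show ?thesis by (intro exI[of _ "p + xhat"]) (simp add: next_site_def moves_left_def)
    next
      assume "moves_down S (p + yhat)"
      then show ?thesis by (intro exI[of _ "p + yhat"]) (simp add: next_site_def moves_down_def)
    qed
    then show ?thesis using next' by blast
  qed
  have "defects (step S) \<subseteq> box x R"
    using next' synd_step_origin[of S] unfolding defects_def by blast
  moreover have "edge_supp (corr (step S)) \<subseteq> box x R"
    using corr synd
    by (auto simp: edge_supp_def step_def edge_add_def flips_def moves_left_def moves_down_def)
  moreover have "(i = 0 \<longrightarrow> fst x - R \<le> fst p) \<and> (j = 0 \<longrightarrow> snd x - R \<le> snd p)"
    if "msg (step S) i j p" for i j p
  proof -
    from that have "synd S p \<or> enters S p \<or> msg S i j p \<or> msg S i j (nbr_x i p) \<or> msg S i j (nbr_y j p)"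
      by (auto simp: step_def msg_update_def)
    then consider "p \<in> box x R" | "msg S i j p" | "msg S i j (nbr_x i p)" | "msg S i j (nbr_y j p)"
      using synd ent by blast
    then show ?thesis
    proof cases
      case 1
      then show ?thesis by (auto simp: box_def)
    next
      case 2
      then show ?thesis by (rule msg)
    next
      case 3
      then show ?thesis using msg[OF 3] by (simp add: nbr_x_def) linarith
    next
      case 4
      then show ?thesis using msg[OF 4] by (simp add: nbr_y_def) linarith
    qed
  qed
  ultimately show ?thesis by (simp add: confined_def)
qed

lemma confined_decoder:
  assumes "defects (init e) \<subseteq> box x R"
  shows "confined x R (decoder e t)"
proof (induction t)
  case 0
  then show ?case using assms by (simp add: decoder_def confined_def init_def edge_supp_def)
next
  case (Suc t)
  then show ?case by (simp add: decoder_Suc confined_step)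
qed

section \<open>Parity and elimination of all defects\<close>

lemma even_card_syndrome:
  assumes "finite (edge_supp e)"
  shows "even (card {p. syndrome e p})"
proof -
  have fin: "finite {p. f (p + a)}" if "finite {p. f p}" for f and a :: site
  proof -
    have "{p. f (p + a)} = (\<lambda>p. p - a) ` {p. f p}"
      by (auto intro!: image_eqI[of _ _ "_ + a"])
    then show ?thesis using that by simp
  qed
  have card: "card {p. f (p + a)} = card {p. f p}" for f and a :: site
    by (rule bij_betw_same_card[of "\<lambda>p. p + a"], rule bij_betw_byWitness[where f' = "\<lambda>p. p - a"]) auto
  have x: "finite {p. edge_x e p}" and y: "finite {p. edge_y e p}"
    using assms by (auto simp: edge_supp_def intro: finite_subset[rotated])
  define F where "F = {p. edge_x e p} \<union> {p. edge_x e (p + xhat)} \<union> {p. edge_y e p} \<union> {p. edge_y e (p + yhat)}"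
  have F: "finite F" using fin[OF x] fin[OF y] x y by (simp add: F_def)
  define n :: "site \<Rightarrow> nat" where "n p = of_bool (edge_x e p) + of_bool (edge_x e (p + xhat)) +
    of_bool (edge_y e p) + of_bool (edge_y e (p + yhat))" for p
  have "sum n F = card {p. edge_x e p} + card {p. edge_x e (p + xhat)} +
      card {p. edge_y e p} + card {p. edge_y e (p + yhat)}"
    using F by (simp add: n_def sum.distrib sum_of_bool_eq) (auto simp: F_def intro!: arg_cong2[of _ _ _ _ "(+)"] arg_cong[of _ _ card])
  \<comment> \<open>Handshake count: each error is seen from both its endpoints, and translates have
    equal cardinality.\<close>
  also have "\<dots> = 2 * (card {p. edge_x e p} + card {p. edge_y e p})"
    by (simp add: card)
  finally have "even (sum n F)" by simp
  then have "even (card {p \<in> F. odd (n p)})"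
    using even_sum_iff[OF F] by blast
  moreover have "{p \<in> F. odd (n p)} = {p. syndrome e p}"
  proof -
    have "p \<in> F" if "odd (n p)" for p
      using that by (auto simp: F_def n_def)
    then show ?thesis by (auto simp: n_def syndrome_def)
  qed
  ultimately show ?thesis by simp
qed

text \<open>In the box each worldline loses at most \<open>4 * R\<close> of height and distances are
  at most \<open>4 * R\<close>, so \<open>pursuit_time\<close> allows at most
  \<open>8 * (8 * R) + 2 * (4 * R) = 72 * R\<close> periods of three steps. The extra 4 steps make
  the number of full periods exceed this.\<close>

lemma at_most_one_defect:
  assumes conf: "\<And>t. confined x R (decoder e t)"
    and "p \<in> defects (decoder e T)" "q \<in> defects (decoder e T)"
    and T: "216 * R + 4 \<le> int T"
  shows "p = q"
proof (rule ccontr)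
  assume "p \<noteq> q"
  obtain v where v: "worldline e T v" "v T = p"
    using worldline_exists assms(2) unfolding defects_def by blast
  obtain w where w: "worldline e T w" "w T = q"
    using worldline_exists assms(3) unfolding defects_def by blast
  have in_box: "u t \<in> box x R" if "worldline e T u" "t \<le> T" for u t
    using that conf[of t] by (auto simp: worldline_def confined_def defects_def)
  have "0 \<le> R" using in_box[OF v(1), of 0] by (auto simp: box_def)
  define K where "K = (T - 1) div 3"
  have K: "3 * K + 1 \<le> T" "72 * R < int K"
    using T \<open>0 \<le> R\<close> unfolding K_def by linarith+
  let ?P = "\<lambda>k. v (3 * k + 1)" and ?Q = "\<lambda>k. w (3 * k + 1)"
  have pull: "pulled_by K ?P ?Q" "pulled_by K ?Q ?P"
    unfolding pulled_by_def
    using worldline_pulled[OF v(1) w(1)] worldline_pulled[OF w(1) v(1)] K(1) by auto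
  have box: "?P k \<in> box x R" "?Q k \<in> box x R" if "k \<le> K" for k
    using in_box v(1) w(1) that K(1) by auto
  have "int K \<le> 8 * (height (?P 0) + height (?Q 0) - height (?P K) - height (?Q K)) + 2 * (4 * R)"
  proof (rule pursuit_time[OF _ _ pull])
    show "?P k \<noteq> ?Q k" if "k \<le> K" for k
      using worldline_disjoint[OF v(1) w(1)] v(2) w(2) \<open>p \<noteq> q\<close> that K(1) by simp
    show "l1_dist (?P k) (?Q k) \<le> 4 * R" if "k \<le> K" for k
      using box[OF that] by (auto simp: l1_dist_def box_def)
  qed (use worldline_descending v(1) w(1) K(1) in auto)
  moreover have "\<bar>height (?P k) - height x\<bar> \<le> 2 * R" "\<bar>height (?Q k) - height x\<bar> \<le> 2 * R" if "k \<le> K" for k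
    using box[OF that] by (auto simp: height_def box_def)
  from this[of 0] this[of K]
  have "height (?P 0) + height (?Q 0) - height (?P K) - height (?Q K) \<le> 8 * R"
    by linarith
  ultimately show False using K(2) unfolding ring_distribs by linarith
qed

lemma finite_box: "finite (box x R)"
  by (simp add: box_def)

lemma edge_supp_edge_add: "edge_supp (edge_add e f) \<subseteq> edge_supp e \<union> edge_supp f"
  by (auto simp: edge_supp_def edge_add_def)

text \<open>Parity excludes a lone survivor; confinement makes the correction finite, so that parity
  applies.\<close>

lemma no_defects:
  assumes "finite (edge_supp e)" "\<And>t. confined x R (decoder e t)" "216 * R + 4 \<le> int T"
  shows "defects (decoder e T) = {}"
proof (rule ccontr)
  assume "defects (decoder e T) \<noteq> {}"
  then obtain p where "defects (decoder e T) = {p}"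
    using at_most_one_defect[OF assms(2) _ _ assms(3)] by blast
  moreover have "finite (edge_supp (corr (decoder e T)))"
    using assms(2)[of T] finite_box finite_subset unfolding confined_def by blast
  then have "finite (edge_supp (edge_add e (corr (decoder e T))))"
    using assms(1) edge_supp_edge_add finite_subset by blast
  then have "even (card (defects (decoder e T)))"
    unfolding defects_def synd_decoder by (rule even_card_syndrome)
  ultimately show False by simp
qed

section \<open>From boxes to balls, and the final constant\<close>

lemma box_l1_ball:
  assumes "real_of_int (2 * R) \<le> r"
  shows "box x R \<subseteq> l1_ball x r"
proof
  fix p assume "p \<in> box x R"
  then have "\<bar>fst p - fst x\<bar> + \<bar>snd p - snd x\<bar> \<le> 2 * R"
    by (auto simp: box_def)
  then have "real_of_int (\<bar>fst p - fst x\<bar> + \<bar>snd p - snd x\<bar>) \<le> real_of_int (2 * R)"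
    by (simp only: of_int_le_iff)
  then show "p \<in> l1_ball x r"
    using assms unfolding l1_ball_def by simp
qed

lemma edge_supp_box:
  assumes "edge_supp e \<subseteq> l1_ball x r"
  shows "edge_supp e \<subseteq> box x \<lfloor>r\<rfloor>"
proof
  fix p assume "p \<in> edge_supp e"
  then have "real_of_int (\<bar>fst p - fst x\<bar> + \<bar>snd p - snd x\<bar>) \<le> r"
    using assms by (auto simp: l1_ball_def)
  then have "\<bar>fst p - fst x\<bar> + \<bar>snd p - snd x\<bar> \<le> \<lfloor>r\<rfloor>"
    by (simp only: le_floor_iff)
  then show "p \<in> box x \<lfloor>r\<rfloor>"
    by (cases p) (simp add: box_def, linarith)
qed

text \<open>An owned edge also touches the site to the left of or below its owner, hence the margin
  of one.\<close>

lemma defects_init_box: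
  assumes "edge_supp e \<subseteq> box x R"
  shows "defects (init e) \<subseteq> box x (R + 1)"
proof
  fix p assume "p \<in> defects (init e)"
  then have "p \<in> edge_supp e \<or> p + xhat \<in> edge_supp e \<or> p + yhat \<in> edge_supp e"
    by (auto simp: defects_def init_def syndrome_def edge_supp_def)
  then have "p \<in> box x R \<or> p + xhat \<in> box x R \<or> p + yhat \<in> box x R"
    using assms by blast
  then show "p \<in> box x (R + 1)"
    by (cases p) (auto simp: box_def)
qed

theorem theorem5p8:
  shows "\<exists>a::real. a \<ge> 1 \<and>
    (\<forall>(e :: edge_config) (x :: site) (r :: real). r \<ge> 1 \<longrightarrow> edge_supp e \<subseteq> l1_ball x r \<longrightarrow>
      (\<exists>t::nat. real t \<le> a * r \<and> (\<forall>t'\<ge>t. defects (decoder e t') = {})) \<and>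
      (\<forall>t::nat. edge_supp (corr (decoder e t)) \<subseteq> l1_ball x (a * r) \<and>
                defects (decoder e t) \<subseteq> l1_ball x (a * r)))"
proof (intro exI[of _ "436::real"] conjI allI impI)
  fix e :: edge_config and x :: site and r :: real
  assume r: "r \<ge> 1" and supp: "edge_supp e \<subseteq> l1_ball x r"
  define R where "R = \<lfloor>r\<rfloor> + 1"
  have R: "real_of_int R \<le> 2 * r" "0 \<le> R"
    using r unfolding R_def by linarith+
  have e: "edge_supp e \<subseteq> box x \<lfloor>r\<rfloor>"
    using edge_supp_box[OF supp] .
  then have conf: "confined x R (decoder e t)" for t
    unfolding R_def by (intro confined_decoder defects_init_box)
  have fin: "finite (edge_supp e)"
    using e finite_box finite_subset by blast
  show "\<exists>t::nat. real t \<le> 436 * r \<and> (\<forall>t'\<ge>t. defects (decoder e t') = {})"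
  proof (intro exI[of _ "nat (216 * R + 4)"] conjI allI impI)
    \<comment> \<open>\<open>R <= 2 * r\<close> gives \<open>432 * r\<close>, and
      \<open>r >= 1\<close> absorbs the 4 into \<open>4 * r\<close>.\<close>
    show "real (nat (216 * R + 4)) \<le> 436 * r" using R r by simp
    show "defects (decoder e t') = {}" if "nat (216 * R + 4) \<le> t'" for t'
      using that by (intro no_defects[OF fin conf]) linarith
  qed
  have "box x R \<subseteq> l1_ball x (436 * r)"
    using R r by (intro box_l1_ball) simp
  then show "edge_supp (corr (decoder e t)) \<subseteq> l1_ball x (436 * r)"
    "defects (decoder e t) \<subseteq> l1_ball x (436 * r)" for t
    using conf[of t] by (auto simp: confined_def)
qed simp

end
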